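(* Let $n$ be a positive integer and let $Z=(z_{ij})$ be an $n\times n$ complex matrix such that $$\left|1-z_{ij}\right|\le 0.5\quad\text{for all }1\le i,j\le n.$$ Then $\operatorname{per}Z\ne 0$.
   Context: The permanent of an $n\times n$ matrix $Z=(z_{ij})$ is $\operatorname{per}Z=\sum_{\sigma\in S_n}\prod_{i=1}^n z_{i\sigma(i)}$, where $S_n$ is the symmetric group of permutations of $\{1,\dots,n\}$. *)

theory Defs
  imports Complex_Main "HOL-Combinatorics.Permutations" "Jordan_Normal_Form.Matrix"
begin

(* Like det in Jordan_Normal_Form.Determinant: rows and columns are numbered from 0,
   and a non-square matrix gets the dummy value 0. *)
definition permanent :: "'a :: comm_semiring_1 mat \<Rightarrow> 'a" where
  "permanent A = (if dim_row A = dim_col A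
     then \<Sum>p \<in> {p. p permutes {0..<dim_row A}}. \<Prod>i = 0..<dim_row A. A $$ (i, p i)
     else 0)"

end

theory Submission
  imports Defs
begin

text \<open>
  A bound of \<open>1/2\<close> on the distance of the entries from \<open>1\<close> makes the right angle a
  self-reproducing bound in an induction on the size of the matrix. The statement carried through
  the induction says more than that the permanent is nonzero: whenever two admissible matrices
  differ in a single row, the angle between their permanents is at most \<open>\<pi>/2\<close>, that is,
  \<open>Re (v * cnj w) \<ge> 0\<close>.

  Expanding along the row \<open>r\<close> in which the matrices differ writes both permanents as combinations
  \<open>\<Sum>b. a b * u b\<close> of the same minors \<open>u b\<close>. Any two of these minors are permanents of matrices which,
  after a permutation of columns, differ in one column only; as the permanent is invariant under
  transposition, the induction hypothesis makes the \<open>u b\<close> nonzero and pairwise at angle at most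
  \<open>\<pi>/2\<close>. Such numbers fit into a rotated quadrant, so little cancels in their sum \<open>s\<close>:
  \<open>\<Sum>b. \<bar>u b\<bar> \<le> sqrt 2 * \<bar>s\<bar>\<close> (lemma \<open>sum_norm_le_of_pairwise_acute\<close>). Replacing the coefficients
  \<open>1\<close> by numbers \<open>a b\<close> within \<open>1/2\<close> of \<open>1\<close> moves \<open>s\<close> by at most
  \<open>1/2 * sqrt 2 * \<bar>s\<bar> = \<bar>s\<bar> / sqrt 2\<close>. Since \<open>1 / sqrt 2\<close> is the sine of \<open>\<pi>/4\<close>, each of the two
  permanents is nonzero and makes an angle of at most \<open>\<pi>/4\<close> with \<open>s\<close>, hence of at most \<open>\<pi>/2\<close> with
  the other (lemma \<open>acute_of_near_common\<close>), and the induction closes.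
\<close>

section \<open>Complex numbers at pairwise angles of at most a right angle\<close>

text \<open>
  Rotating by \<open>cnj m\<close> for the \<open>m\<close> found here puts all of \<open>A\<close> into the closed first quadrant.
  Inside a half-plane the relation "no further clockwise than" is transitive, so in the induction a
  new element \<open>a\<close> has to be compared with the previous extreme element only.
\<close>
lemma exists_clockwise_most:
  fixes A :: "complex set"
  assumes "finite A" "A \<noteq> {}" "0 \<notin> A" "\<And>u v. u \<in> A \<Longrightarrow> v \<in> A \<Longrightarrow> Re (u * cnj v) \<ge> 0"
  shows "\<exists>m\<in>A. \<forall>k\<in>A. Im (k * cnj m) \<ge> 0"
  using assms
proof (induction rule: finite_ne_induct)
  case (singleton x)
  then show ?case by simp
next
  case (insert a F)
  then obtain m where m: "m \<in> F" "\<And>k. k \<in> F \<Longrightarrow> Im (k * cnj m) \<ge> 0"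
    by (metis insertCI)
  show ?case
  proof (cases "Im (a * cnj m) \<ge> 0")
    case True
    then show ?thesis using m by blast
  next
    case False
    have "Im (k * cnj a) \<ge> 0" if k: "k \<in> F" for k
    proof -
      have "Im (m * cnj a) \<ge> 0" using False by (simp add: mult.commute)
      moreover have "Re (m * cnj a) \<ge> 0" "Re (k * cnj m) \<ge> 0"
        using insert.prems m(1) k by blast+
      ultimately have "0 \<le> Im ((k * cnj m) * (m * cnj a))"
        unfolding times_complex.sel(2)[of "k * cnj m"] using m(2)[OF k]
        by (intro add_nonneg_nonneg mult_nonneg_nonneg)
      also have "(k * cnj m) * (m * cnj a) = of_real ((cmod m)\<^sup>2) * (k * cnj a)"
        by (simp add: complex_norm_square algebra_simps del: of_real_power)
      finally have "0 \<le> (cmod m)\<^sup>2 * Im (k * cnj a)"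
        by (simp only: Im_complex_of_real Re_complex_of_real times_complex.sel(2)[of "of_real _"]
            mult_zero_left add_0_right)
      moreover have "(cmod m)\<^sup>2 > 0" using m(1) insert.prems(1) by auto
      ultimately show ?thesis by (simp add: zero_le_mult_iff)
    qed
    moreover have "Im (a * cnj a) \<ge> 0" by simp
    ultimately show ?thesis by blast
  qed
qed

text \<open>
  In the first quadrant \<open>\<bar>v\<bar> \<le> Re v + Im v\<close>, and the right-hand side is additive; applied to the sum, it
  is at most \<open>sqrt 2\<close> times the modulus. The numbers are first rotated into that quadrant.
\<close>
lemma sum_norm_le_of_pairwise_acute:
  fixes u :: "'a \<Rightarrow> complex"
  assumes "finite I" "\<And>i. i \<in> I \<Longrightarrow> u i \<noteq> 0"
    and "\<And>i j. i \<in> I \<Longrightarrow> j \<in> I \<Longrightarrow> Re (u i * cnj (u j)) \<ge> 0"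
  shows "(\<Sum>i\<in>I. cmod (u i)) \<le> sqrt 2 * cmod (\<Sum>i\<in>I. u i)"
proof (cases "I = {}")
  case True
  then show ?thesis by simp
next
  case False
  have "\<exists>m\<in>u ` I. \<forall>k\<in>u ` I. Im (k * cnj m) \<ge> 0"
    by (rule exists_clockwise_most) (use assms False in auto)
  then obtain l where l: "l \<in> I" "\<And>i. i \<in> I \<Longrightarrow> Im (u i * cnj (u l)) \<ge> 0"
    by auto
  define v where "v = (\<lambda>i. u i * cnj (u l))"
  have sum_v: "(\<Sum>i\<in>I. v i) = (\<Sum>i\<in>I. u i) * cnj (u l)"
    by (simp add: v_def sum_distrib_right)
  have "(\<Sum>i\<in>I. cmod (u i)) * cmod (u l) = (\<Sum>i\<in>I. cmod (v i))"
    by (simp add: v_def sum_distrib_right norm_mult)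
  also have "\<dots> \<le> (\<Sum>i\<in>I. Re (v i) + Im (v i))"
  proof (rule sum_mono)
    fix i assume "i \<in> I"
    then have "Re (v i) \<ge> 0" "Im (v i) \<ge> 0"
      using assms(3) l unfolding v_def by blast+
    then show "cmod (v i) \<le> Re (v i) + Im (v i)"
      using cmod_le[of "v i"] by simp
  qed
  also have "\<dots> = Re (\<Sum>i\<in>I. v i) + Im (\<Sum>i\<in>I. v i)"
    by (simp add: sum.distrib)
  also have "\<dots> \<le> sqrt 2 * cmod (\<Sum>i\<in>I. v i)"
    using complex_abs_le_norm[of "\<Sum>i\<in>I. v i"] by linarith
  also have "\<dots> = sqrt 2 * cmod (\<Sum>i\<in>I. u i) * cmod (u l)"
    by (simp only: sum_v norm_mult complex_mod_cnj mult.assoc)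
  finally show ?thesis
    using assms(2)[OF l(1)] by simp
qed

text \<open>
  The boundary lines \<open>\<bar>Im z\<bar> = Re z\<close> of this quadrant are tangent to the disc about \<open>1\<close> of radius
  \<open>1 / sqrt 2\<close>.
\<close>
lemma disc_subset_quadrant:
  assumes "cmod (z - 1) \<le> 1 / sqrt 2"
  shows "\<bar>Im z\<bar> \<le> Re z"
proof -
  have "\<bar>Re (z - 1)\<bar> + \<bar>Im (z - 1)\<bar> \<le> sqrt 2 * cmod (z - 1)"
    by (rule complex_abs_le_norm)
  also have "\<dots> \<le> sqrt 2 * (1 / sqrt 2)"
    using assms by (intro mult_left_mono) auto
  finally show ?thesis by simp
qed

text \<open>
  After division by \<open>u\<close>, both numbers lie within an angle of \<open>\<pi>/4\<close> of the positive real axis.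
\<close>
lemma acute_of_near_common:
  assumes "u \<noteq> 0" "cmod (v - u) \<le> cmod u / sqrt 2" "cmod (w - u) \<le> cmod u / sqrt 2"
  shows "Re (v * cnj w) \<ge> 0"
proof -
  have quadrant: "\<bar>Im (x / u)\<bar> \<le> Re (x / u)" if "cmod (x - u) \<le> cmod u / sqrt 2" for x
  proof (rule disc_subset_quadrant)
    have "cmod (x / u - 1) = cmod (x - u) / cmod u"
      using assms(1) by (simp add: diff_divide_distrib flip: norm_divide)
    then show "cmod (x / u - 1) \<le> 1 / sqrt 2"
      using that assms(1) by (simp only:) (simp add: divide_simps mult.commute)
  qed
  have "0 \<le> Re (v / u) * Re (w / u) + Im (v / u) * Im (w / u)"
  proof -
    have "\<bar>Im (v / u) * Im (w / u)\<bar> \<le> Re (v / u) * Re (w / u)"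
      unfolding abs_mult by (intro mult_mono quadrant assms order_trans[OF abs_ge_zero quadrant]) auto
    then show ?thesis by linarith
  qed
  also have "\<dots> = Re ((v / u) * cnj (w / u))"
    by (simp only: times_complex.sel cnj.sel mult_minus_right diff_minus_eq_add)
  also have "(v / u) * cnj (w / u) = v * cnj w / of_real ((cmod u)\<^sup>2)"
    by (simp add: complex_norm_square del: of_real_power)
  also have "Re \<dots> = Re (v * cnj w) / (cmod u)\<^sup>2"
    by (rule Re_divide_of_real)
  finally show ?thesis using assms(1) by (simp add: zero_le_divide_iff)
qed

text \<open>
  The factor \<open>1/2\<close> allowed for the coefficients and the factor \<open>sqrt 2\<close> lost to cancellation combine
  to the radius \<open>1 / sqrt 2\<close> demanded by \<open>acute_of_near_common\<close>.
\<close>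
lemma combination_near_sum:
  fixes u a :: "'a \<Rightarrow> complex"
  assumes "finite I" "\<And>i. i \<in> I \<Longrightarrow> u i \<noteq> 0"
    and "\<And>i j. i \<in> I \<Longrightarrow> j \<in> I \<Longrightarrow> Re (u i * cnj (u j)) \<ge> 0"
    and "\<And>i. i \<in> I \<Longrightarrow> cmod (1 - a i) \<le> 1/2"
  shows "cmod ((\<Sum>i\<in>I. a i * u i) - (\<Sum>i\<in>I. u i)) \<le> cmod (\<Sum>i\<in>I. u i) / sqrt 2"
proof -
  have "(\<Sum>i\<in>I. a i * u i) - (\<Sum>i\<in>I. u i) = (\<Sum>i\<in>I. (a i - 1) * u i)"
    by (simp add: algebra_simps sum_subtractf)
  also have "cmod \<dots> \<le> (\<Sum>i\<in>I. 1/2 * cmod (u i))"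
  proof (rule sum_norm_le)
    fix i assume "i \<in> I"
    then show "cmod ((a i - 1) * u i) \<le> 1/2 * cmod (u i)"
      unfolding norm_mult using assms(4) by (intro mult_right_mono) (auto simp: norm_minus_commute)
  qed
  also have "\<dots> = 1/2 * (\<Sum>i\<in>I. cmod (u i))"
    by (simp add: sum_distrib_left)
  also have "\<dots> \<le> 1/2 * (sqrt 2 * cmod (\<Sum>i\<in>I. u i))"
    by (intro mult_left_mono sum_norm_le_of_pairwise_acute assms) auto
  also have "\<dots> = cmod (\<Sum>i\<in>I. u i) / sqrt 2"
    by (simp add: field_simps)
  finally show ?thesis .
qed

lemma nonzero_of_near:
  assumes "u \<noteq> 0" "cmod (v - u) \<le> cmod u / sqrt 2"
  shows "v \<noteq> 0"
proof
  assume "v = 0"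
  then have "sqrt 2 \<le> 1" using assms by (simp add: field_simps)
  then show False by simp
qed

section \<open>Permanents over a finite index set\<close>

text \<open>
  With an arbitrary finite index set in place of \<open>{0..<n}\<close>, a minor is again a permanent over a
  subset, and no renumbering of rows and columns is required.
\<close>
definition set_permanent :: "('a \<Rightarrow> 'a \<Rightarrow> 'b :: comm_semiring_1) \<Rightarrow> 'a set \<Rightarrow> 'b" where
  "set_permanent z S = (\<Sum>p | p permutes S. \<Prod>i\<in>S. z i (p i))"

lemma set_permanent_cong:
  assumes "\<And>i j. i \<in> S \<Longrightarrow> j \<in> S \<Longrightarrow> z i j = z' i j"
  shows "set_permanent z S = set_permanent z' S"
  unfolding set_permanent_def
  by (intro sum.cong prod.cong refl assms) (auto simp: permutes_in_image)

lemma set_permanent_transpose: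
  "set_permanent (\<lambda>i j. z j i) S = set_permanent z S"
proof -
  have "set_permanent (\<lambda>i j. z j i) S = (\<Sum>p | p permutes S. \<Prod>i\<in>S. z (inv_into UNIV p i) i)"
    unfolding set_permanent_def by (rule sum_permutations_inverse)
  also have "\<dots> = set_permanent z S"
    unfolding set_permanent_def
  proof (intro sum.cong refl)
    fix p assume "p \<in> {p. p permutes S}"
    then have p: "p permutes S" by simp
    show "(\<Prod>i\<in>S. z (inv_into UNIV p i) i) = (\<Prod>i\<in>S. z i (p i))"
      by (subst prod.permute[OF p]) (simp add: o_def permutes_inverses[OF p])
  qed
  finally show ?thesis .
qed

lemma set_permanent_permute_columns:
  assumes "q permutes S"
  shows "set_permanent (\<lambda>i j. z i (q j)) S = set_permanent z S"
proof -
  have "set_permanent z S = (\<Sum>p | p permutes S. \<Prod>i\<in>S. z i ((q \<circ> p) i))"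
    unfolding set_permanent_def by (rule setum_permutations_compose_left[OF assms])
  then show ?thesis by (simp add: set_permanent_def)
qed

text \<open>
  The minor without row \<open>r\<close> and column \<open>b\<close> has the columns \<open>insert r T - {b}\<close>. To index it by
  \<open>T\<close> on both sides, column \<open>r\<close> takes the vacant place \<open>b\<close>; the transposition encodes this, and
  it is the identity for \<open>b = r\<close>.
\<close>
lemma set_permanent_expand_row:
  assumes "finite T" "r \<notin> T"
  shows "set_permanent z (insert r T) =
    (\<Sum>b\<in>insert r T. z r b * set_permanent (\<lambda>i j. z i (Transposition.transpose r b j)) T)"
proof -
  have "(\<Prod>i\<in>insert r T. z i ((Transposition.transpose r b \<circ> q) i)) = z r b * (\<Prod>i\<in>T. z i (Transposition.transpose r b (q i)))"
    if "q permutes T" for b q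
    using assms permutes_not_in[OF that assms(2)] by simp
  then show ?thesis
    unfolding set_permanent_def sum_over_permutations_insert[OF assms]
    by (simp add: sum_distrib_left)
qed

text \<open>
  The minors belonging to \<open>b\<close> and \<open>c\<close> share all columns but one: the first contains column \<open>c\<close>, the
  second column \<open>b\<close>. The permutations \<open>q\<close> and \<open>q'\<close> line up the shared columns.
\<close>
lemma minors_differ_in_one_column:
  assumes "r \<notin> T" "b \<in> insert r T" "c \<in> insert r T" "b \<noteq> c"
  obtains q q' d where "q permutes T" "q' permutes T" "d \<in> T"
    "\<forall>j\<in>T - {d}. Transposition.transpose r b (q j) = Transposition.transpose r c (q' j)"
proof (cases "b = r")
  case True
  then show ?thesis
    using assms by (intro that[of id id c]) (auto simp: Transposition.transpose_def)
next
  case False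
  show ?thesis
  proof (cases "c = r")
    case True
    then show ?thesis
      using assms False by (intro that[of id id b]) (auto simp: Transposition.transpose_def)
  next
    case c: False
    then have "Transposition.transpose b c permutes T"
      using assms False by (intro permutes_swap_id) auto
    then show ?thesis
      using assms False c
      by (intro that[of "Transposition.transpose b c" id b]) (auto simp: Transposition.transpose_def)
  qed
qed

section \<open>The induction\<close>

text \<open>
  Nonvanishing alone is not inductive, as a sum of nonzero minors may vanish; the angle bound for
  matrices differing in one row excludes that. The entry bound is imposed on all indices, so that it
  passes to minors and transposes without conditions on where an index lies.
\<close>
lemma set_permanent_nonzero_and_acute:
  fixes z :: "'a \<Rightarrow> 'a \<Rightarrow> complex"
  assumes "finite S" "\<And>i j. cmod (1 - z i j) \<le> 1/2"
  shows "set_permanent z S \<noteq> 0"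
    and "\<lbrakk>r \<in> S; \<And>i j. cmod (1 - z' i j) \<le> 1/2; \<And>i j. i \<in> S - {r} \<Longrightarrow> z' i j = z i j\<rbrakk>
      \<Longrightarrow> Re (set_permanent z S * cnj (set_permanent z' S)) \<ge> 0"
proof -
  have "set_permanent z S \<noteq> 0 \<and>
    (\<forall>r\<in>S. \<forall>z'. (\<forall>i j. cmod (1 - z' i j) \<le> 1/2) \<longrightarrow> (\<forall>i\<in>S-{r}. \<forall>j. z' i j = z i j) \<longrightarrow>
      Re (set_permanent z S * cnj (set_permanent z' S)) \<ge> 0)"
    using assms
  proof (induction S arbitrary: z rule: finite_psubset_induct)
    case (psubset S)
    \<comment> \<open>The number \<open>u\<close>, the permanent after replacing row \<open>r\<close> by ones, depends only on the other rows, and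
      so is near the permanents of all matrices that agree with \<open>z\<close> there.\<close>
    have near: "\<exists>u. u \<noteq> 0 \<and> (\<forall>z'. (\<forall>i j. cmod (1 - z' i j) \<le> 1/2) \<longrightarrow>
        (\<forall>i\<in>S-{r}. \<forall>j. z' i j = z i j) \<longrightarrow> cmod (set_permanent z' S - u) \<le> cmod u / sqrt 2)"
      if r: "r \<in> S" for r
    proof -
      define T where "T = S - {r}"
      have T: "finite T" "r \<notin> T" "insert r T = S" "T \<subset> S"
        using r psubset.hyps by (auto simp: T_def)
      define u where "u = (\<lambda>b. set_permanent (\<lambda>i j. z i (Transposition.transpose r b j)) T)"
      have u_nonzero: "u b \<noteq> 0" for b
        unfolding u_def
        using psubset.IH[OF T(4), of "\<lambda>i j. z i (Transposition.transpose r b j)"] psubset.prems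
        by simp
      have u_acute: "Re (u b * cnj (u c)) \<ge> 0" if bc: "b \<in> S" "c \<in> S" for b c
      proof (cases "b = c")
        case True
        then show ?thesis by simp
      next
        case False
        have "b \<in> insert r T" "c \<in> insert r T" using bc T(3) by simp_all
        then obtain q q' d where q: "q permutes T" "q' permutes T" "d \<in> T"
            "\<forall>j\<in>T - {d}. Transposition.transpose r b (q j) = Transposition.transpose r c (q' j)"
          by (rule minors_differ_in_one_column[OF T(2) _ _ False])
        \<comment> \<open>The induction hypothesis speaks of rows, so the two minors are transposed.\<close>
        define x where "x = (\<lambda>j i. z i (Transposition.transpose r b (q j)))"
        define y where "y = (\<lambda>j i. z i (Transposition.transpose r c (q' j)))"
        have "set_permanent x T = u b"
          unfolding u_def x_def
          by (rule trans[OF set_permanent_transpose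
                set_permanent_permute_columns[OF q(1), of "\<lambda>i j. z i (Transposition.transpose r b j)"]])
        moreover have "set_permanent y T = u c"
          unfolding u_def y_def
          by (rule trans[OF set_permanent_transpose
                set_permanent_permute_columns[OF q(2), of "\<lambda>i j. z i (Transposition.transpose r c j)"]])
        moreover have "Re (set_permanent x T * cnj (set_permanent y T)) \<ge> 0"
        proof -
          have "\<And>i j. cmod (1 - x i j) \<le> 1/2" "\<And>i j. cmod (1 - y i j) \<le> 1/2"
            using psubset.prems by (auto simp: x_def y_def)
          moreover have "\<forall>i\<in>T-{d}. \<forall>j. y i j = x i j"
            using q(4) by (simp add: x_def y_def)
          ultimately show ?thesis using psubset.IH[OF T(4), of x] q(3) by blast
        qed
        ultimately show ?thesis by simp
      qed
      have "(\<Sum>b\<in>S. u b) \<noteq> 0"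
      proof
        assume "(\<Sum>b\<in>S. u b) = 0"
        then have "(\<Sum>b\<in>S. cmod (u b)) \<le> 0"
          using sum_norm_le_of_pairwise_acute[of S u] psubset.hyps u_nonzero u_acute by simp
        moreover have "(\<Sum>b\<in>S. cmod (u b)) > 0"
          using psubset.hyps r u_nonzero by (intro sum_pos) auto
        ultimately show False by linarith
      qed
      moreover have "cmod (set_permanent z' S - (\<Sum>b\<in>S. u b)) \<le> cmod (\<Sum>b\<in>S. u b) / sqrt 2"
        if z': "\<forall>i j. cmod (1 - z' i j) \<le> 1/2" "\<forall>i\<in>S-{r}. \<forall>j. z' i j = z i j" for z'
      proof -
        have "set_permanent (\<lambda>i j. z' i (Transposition.transpose r b j)) T = u b" for b
          unfolding u_def using z'(2) by (intro set_permanent_cong) (simp add: T_def)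
        then have "set_permanent z' S = (\<Sum>b\<in>S. z' r b * u b)"
          using set_permanent_expand_row[OF T(1,2), of z'] unfolding T(3) by simp
        then show ?thesis
          using combination_near_sum[of S u "z' r"] psubset.hyps u_nonzero u_acute z'(1) by simp
      qed
      ultimately show ?thesis by blast
    qed
    have "set_permanent z S \<noteq> 0"
    proof (cases "S = {}")
      case True
      then show ?thesis by (simp add: set_permanent_def)
    next
      case False
      then obtain r where "r \<in> S" by blast
      then show ?thesis using near[of r] psubset.prems nonzero_of_near by blast
    qed
    moreover have "Re (set_permanent z S * cnj (set_permanent z' S)) \<ge> 0"
      if "r \<in> S" "\<forall>i j. cmod (1 - z' i j) \<le> 1/2" "\<forall>i\<in>S-{r}. \<forall>j. z' i j = z i j" for r z'
      using near[OF that(1)] psubset.prems that(2,3) acute_of_near_common by metis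
    ultimately show ?case by blast
  qed
  then show "set_permanent z S \<noteq> 0"
    and "\<lbrakk>r \<in> S; \<And>i j. cmod (1 - z' i j) \<le> 1/2; \<And>i j. i \<in> S - {r} \<Longrightarrow> z' i j = z i j\<rbrakk>
      \<Longrightarrow> Re (set_permanent z S * cnj (set_permanent z' S)) \<ge> 0"
    by blast+
qed

theorem theorem1p4:
  fixes n :: nat and Z :: "complex mat"
  assumes "n > 0"
    and "Z \<in> carrier_mat n n"
    and "\<And>i j. i < n \<Longrightarrow> j < n \<Longrightarrow> cmod (1 - Z $$ (i, j)) \<le> 0.5"
  shows "permanent Z \<noteq> 0"
proof -
  \<comment> \<open>Entries outside the matrix are set to \<open>1\<close>, which satisfies the bound trivially.\<close>
  define z where "z = (\<lambda>i j. if i < n \<and> j < n then Z $$ (i, j) else 1)"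
  have "permanent Z = set_permanent (\<lambda>i j. Z $$ (i, j)) {0..<n}"
    using assms(2) by (simp add: permanent_def set_permanent_def)
  also have "\<dots> = set_permanent z {0..<n}"
    by (rule set_permanent_cong) (simp add: z_def)
  also have "\<dots> \<noteq> 0"
    by (rule set_permanent_nonzero_and_acute) (use assms(3) in \<open>auto simp: z_def\<close>)
  finally show ?thesis .
qed

end
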